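(* Let $n\ge 2$ and let $\Sigma=L_1\cup\cdots\cup L_n\subset\mathbb{C}^2$ be a union of $n$ distinct complex lines. Suppose that the fundamental group $\pi_1(\mathbb{C}^2\setminus\Sigma)$ is a free group. Then $\Sigma$ is a union of parallel lines.
   Context: A complex line in $\mathbb{C}^2$ is the solution set of a linear equation $ax+by+c=0$ with $a,b,c\in\mathbb{C}$ and $(a,b)\neq(0,0)$. $\Sigma$ is called a union of parallel lines if the lines $L_1,\dots,L_n$ all have the same slope (the same direction); equivalently, for distinct lines, they are pairwise disjoint. The fundamental group is that of the complement with its topology induced from $\mathbb{C}^2$ (the complement is path connected, so the base point is irrelevant). *)

theory Defs
  imports "HOL-Analysis.Analysis" "HOL-Algebra.Group"
begin

section \<open>Fundamental group\<close>

text \<open>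
  Paths are total functions on the reals, but \<^const>\<open>homotopic_paths\<close> only looks at their
  restriction to the unit interval, so the values outside are irrelevant.
\<close>

definition loops_at :: "'a::topological_space set \<Rightarrow> 'a \<Rightarrow> (real \<Rightarrow> 'a) set" where
  "loops_at S x = {p. path p \<and> path_image p \<subseteq> S \<and> pathstart p = x \<and> pathfinish p = x}"

definition path_class :: "'a::topological_space set \<Rightarrow> (real \<Rightarrow> 'a) \<Rightarrow> (real \<Rightarrow> 'a) set" where
  "path_class S p = {q. homotopic_paths S p q}"

definition fundamental_group ::
    "'a::real_normed_vector set \<Rightarrow> 'a \<Rightarrow> (real \<Rightarrow> 'a) set monoid" where
  "fundamental_group S x =
     \<lparr>carrier = path_class S ` loops_at S x,
      monoid.mult = (\<lambda>A B. \<Union>p\<in>A. \<Union>q\<in>B. path_class S (p +++ q)),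
      one = path_class S (linepath x x)\<rparr>"

lemma path_class_eq_iff:
  assumes "p \<in> loops_at S x"
  shows "path_class S p = path_class S q \<longleftrightarrow> homotopic_paths S p q"
proof
  assume "path_class S p = path_class S q"
  moreover have "p \<in> path_class S p"
    using assms by (simp add: path_class_def loops_at_def)
  ultimately show "homotopic_paths S p q"
    by (metis path_class_def mem_Collect_eq homotopic_paths_sym)
next
  assume "homotopic_paths S p q"
  then show "path_class S p = path_class S q"
    unfolding path_class_def
    by (intro Collect_cong iffI) (meson homotopic_paths_trans homotopic_paths_sym)+
qed

lemma fundamental_group_mult:
  fixes S :: "'a::real_normed_vector set"
  assumes p: "p \<in> loops_at S x" and q: "q \<in> loops_at S x"
  shows "path_class S p \<otimes>\<^bsub>fundamental_group S x\<^esub> path_class S q = path_class S (p +++ q)"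
proof -
  have "path_class S (p' +++ q') = path_class S (p +++ q)"
    if "p' \<in> path_class S p" "q' \<in> path_class S q" for p' q'
  proof -
    have "homotopic_paths S (p +++ q) (p' +++ q')"
      using that p q by (intro homotopic_paths_join) (auto simp: path_class_def loops_at_def)
    moreover have "p +++ q \<in> loops_at S x"
      using p q by (auto simp: loops_at_def path_image_join)
    ultimately show ?thesis
      by (metis path_class_eq_iff)
  qed
  moreover have "p \<in> path_class S p" "q \<in> path_class S q"
    using p q by (auto simp: path_class_def loops_at_def)
  ultimately have "(\<Union>p'\<in>path_class S p. \<Union>q'\<in>path_class S q. path_class S (p' +++ q'))
      = path_class S (p +++ q)"
    by blast
  then show ?thesis
    by (simp add: fundamental_group_def)
qed

lemma group_fundamental_group:
  fixes S :: "'a::real_normed_vector set"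
  assumes x: "x \<in> S"
  shows "group (fundamental_group S x)"
proof -
  let ?G = "fundamental_group S x"
  have car: "carrier ?G = path_class S ` loops_at S x"
    and one: "\<one>\<^bsub>?G\<^esub> = path_class S (linepath x x)"
    by (simp_all add: fundamental_group_def)
  have const: "linepath x x \<in> loops_at S x"
    using x by (auto simp: loops_at_def)
  have join: "p +++ q \<in> loops_at S x" if "p \<in> loops_at S x" "q \<in> loops_at S x" for p q
    using that by (auto simp: loops_at_def path_image_join)
  have rev: "reversepath p \<in> loops_at S x" if "p \<in> loops_at S x" for p
    using that by (auto simp: loops_at_def)
  note m = fundamental_group_mult
  show ?thesis
  proof (rule groupI)
    fix A B assume "A \<in> carrier ?G" "B \<in> carrier ?G"
    then show "A \<otimes>\<^bsub>?G\<^esub> B \<in> carrier ?G"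
      unfolding car using join by (auto simp: m)
  next
    show "\<one>\<^bsub>?G\<^esub> \<in> carrier ?G"
      unfolding car one using const by blast
  next
    fix A B C assume "A \<in> carrier ?G" "B \<in> carrier ?G" "C \<in> carrier ?G"
    then obtain p q r where pqr: "p \<in> loops_at S x" "q \<in> loops_at S x" "r \<in> loops_at S x"
      and eq: "A = path_class S p" "B = path_class S q" "C = path_class S r"
      unfolding car by blast
    have "homotopic_paths S (p +++ (q +++ r)) ((p +++ q) +++ r)"
      using pqr by (intro homotopic_paths_assoc) (auto simp: loops_at_def)
    then have "path_class S ((p +++ q) +++ r) = path_class S (p +++ (q +++ r))"
      using pqr join path_class_eq_iff by metis
    then show "A \<otimes>\<^bsub>?G\<^esub> B \<otimes>\<^bsub>?G\<^esub> C = A \<otimes>\<^bsub>?G\<^esub> (B \<otimes>\<^bsub>?G\<^esub> C)"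
      using pqr join m eq by metis
  next
    fix A assume "A \<in> carrier ?G"
    then obtain p where p: "p \<in> loops_at S x" and A: "A = path_class S p"
      unfolding car by blast
    have "homotopic_paths S (linepath x x +++ p) p"
      using homotopic_paths_lid [of p S] p by (simp add: loops_at_def)
    then show "\<one>\<^bsub>?G\<^esub> \<otimes>\<^bsub>?G\<^esub> A = A"
      unfolding one A using p const join m path_class_eq_iff by metis
    have "homotopic_paths S (reversepath p +++ p) (linepath x x)"
      using homotopic_paths_linv [of p S] p by (simp add: loops_at_def)
    then have "path_class S (reversepath p) \<otimes>\<^bsub>?G\<^esub> A = \<one>\<^bsub>?G\<^esub>"
      unfolding one A using p rev join m path_class_eq_iff by metis
    then show "\<exists>B\<in>carrier ?G. B \<otimes>\<^bsub>?G\<^esub> A = \<one>\<^bsub>?G\<^esub>"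
      unfolding car using p rev by blast
  qed
qed


section \<open>Free groups\<close>

text \<open>The letter \<open>(s, True)\<close> stands for the generator \<open>s\<close>, and \<open>(s, False)\<close> for its inverse.\<close>

type_synonym 'a letter = "'a \<times> bool"

definition inv_letter :: "'a letter \<Rightarrow> 'a letter" where
  "inv_letter a = (fst a, \<not> snd a)"

definition reduced_word :: "'a letter list \<Rightarrow> bool" where
  "reduced_word = successively (\<lambda>a b. b \<noteq> inv_letter a)"

fun cancel_cons :: "'a letter \<Rightarrow> 'a letter list \<Rightarrow> 'a letter list" where
  "cancel_cons a [] = [a]"
| "cancel_cons a (b # w) = (if b = inv_letter a then w else a # b # w)"

definition reduce_word :: "'a letter list \<Rightarrow> 'a letter list" where
  "reduce_word w = foldr cancel_cons w []"

definition free_group_on :: "'a set \<Rightarrow> 'a letter list monoid" where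
  "free_group_on S =
     \<lparr>carrier = {w \<in> lists (S \<times> UNIV). reduced_word w},
      monoid.mult = (\<lambda>u v. reduce_word (u @ v)),
      one = []\<rparr>"

text \<open>
  A generating set may be sought in the element type of the group itself, since an isomorphism
  from a free group embeds the generators into its carrier.
\<close>

definition is_free_group :: "('a, 'b) monoid_scheme \<Rightarrow> bool" where
  "is_free_group G \<longleftrightarrow> group G \<and> (\<exists>S :: 'a set. free_group_on S \<cong> G)"

lemma inv_letter_inv_letter [simp]: "inv_letter (inv_letter a) = a"
  by (simp add: inv_letter_def)

lemma inv_letter_eq_iff [simp]: "inv_letter a = inv_letter b \<longleftrightarrow> a = b"
  by (metis inv_letter_inv_letter)

lemma reduced_word_Nil [simp]: "reduced_word []"
  by (simp add: reduced_word_def)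

lemma reduced_word_ConsD: "reduced_word (a # w) \<Longrightarrow> reduced_word w"
  by (cases w) (auto simp: reduced_word_def)

lemma reduced_cancel_cons: "reduced_word w \<Longrightarrow> reduced_word (cancel_cons a w)"
  by (cases w) (auto simp: reduced_word_def successively_Cons)

lemma reduced_foldr_cancel_cons: "reduced_word w \<Longrightarrow> reduced_word (foldr cancel_cons u w)"
  by (induction u) (auto intro: reduced_cancel_cons)

lemma cancel_cons_inv: "reduced_word w \<Longrightarrow> cancel_cons a (cancel_cons (inv_letter a) w) = w"
proof (cases w)
  case (Cons b v)
  then show "reduced_word w \<Longrightarrow> ?thesis"
    by (cases v) (auto simp: reduced_word_def)
qed simp

lemma foldr_cancel_cons_reduce:
  assumes "reduced_word w"
  shows "foldr cancel_cons (reduce_word u) w = foldr cancel_cons u w"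
proof (induction u)
  case (Cons a u)
  have "foldr cancel_cons (cancel_cons a r) w = cancel_cons a (foldr cancel_cons r w)" for r
    using assms by (cases r) (auto simp: cancel_cons_inv reduced_foldr_cancel_cons)
  with Cons show ?case
    by (simp add: reduce_word_def)
qed (simp add: reduce_word_def)

lemma reduce_word_append_left: "reduce_word (reduce_word u @ v) = reduce_word (u @ v)"
  using foldr_cancel_cons_reduce [of "reduce_word v" u]
  by (simp add: reduce_word_def reduced_foldr_cancel_cons)

lemma reduce_word_reduced: "reduced_word w \<Longrightarrow> reduce_word w = w"
proof (induction w)
  case (Cons a w)
  then show ?case
    by (cases w) (auto simp: reduce_word_def reduced_word_def)
qed (simp add: reduce_word_def)

lemma reduce_word_append_right: "reduce_word (u @ reduce_word v) = reduce_word (u @ v)"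
proof -
  have "reduce_word (reduce_word v) = reduce_word v"
    by (rule reduce_word_reduced) (simp add: reduce_word_def reduced_foldr_cancel_cons)
  then show ?thesis
    by (simp add: reduce_word_def)
qed

lemma set_reduce_word: "set (reduce_word w) \<subseteq> set w"
proof -
  have "set (cancel_cons a v) \<subseteq> insert a (set v)" for a v
    by (cases v) auto
  then show ?thesis
    unfolding reduce_word_def by (induction w) (simp, fastforce)
qed

lemma reduce_word_inverse: "reduce_word (rev (map inv_letter w) @ w) = []"
proof (induction w)
  case (Cons a w)
  have "cancel_cons (inv_letter a) (cancel_cons a (reduce_word w)) = reduce_word w"
    using cancel_cons_inv [of "reduce_word w" "inv_letter a"]
    by (simp add: reduce_word_def reduced_foldr_cancel_cons)
  then have "reduce_word (rev (map inv_letter (a # w)) @ (a # w))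
      = foldr cancel_cons (rev (map inv_letter w)) (reduce_word w)"
    by (simp add: reduce_word_def)
  also have "\<dots> = []"
    using Cons by (simp add: reduce_word_def)
  finally show ?case .
qed (simp add: reduce_word_def)

lemma group_free_group_on: "group (free_group_on S)"
proof (rule groupI)
  fix u v assume "u \<in> carrier (free_group_on S)" "v \<in> carrier (free_group_on S)"
  then show "u \<otimes>\<^bsub>free_group_on S\<^esub> v \<in> carrier (free_group_on S)"
    using set_reduce_word [of "u @ v"] reduced_foldr_cancel_cons [of "[]" "u @ v"]
    by (auto simp: free_group_on_def reduce_word_def)
next
  fix u v w
  show "u \<otimes>\<^bsub>free_group_on S\<^esub> v \<otimes>\<^bsub>free_group_on S\<^esub> w
      = u \<otimes>\<^bsub>free_group_on S\<^esub> (v \<otimes>\<^bsub>free_group_on S\<^esub> w)"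
    by (simp add: free_group_on_def reduce_word_append_left reduce_word_append_right)
next
  fix w assume w: "w \<in> carrier (free_group_on S)"
  then show "\<one>\<^bsub>free_group_on S\<^esub> \<otimes>\<^bsub>free_group_on S\<^esub> w = w"
    by (simp add: free_group_on_def reduce_word_reduced)
  let ?v = "reduce_word (rev (map inv_letter w))"
  have "?v \<in> carrier (free_group_on S)"
    using w set_reduce_word [of "rev (map inv_letter w)"]
      reduced_foldr_cancel_cons [of "[]" "rev (map inv_letter w)"]
    by (fastforce simp: free_group_on_def reduce_word_def inv_letter_def)
  moreover have "?v \<otimes>\<^bsub>free_group_on S\<^esub> w = \<one>\<^bsub>free_group_on S\<^esub>"
    by (simp add: free_group_on_def reduce_word_append_left reduce_word_inverse)
  ultimately show "\<exists>v\<in>carrier (free_group_on S). v \<otimes>\<^bsub>free_group_on S\<^esub> w = \<one>\<^bsub>free_group_on S\<^esub>"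
    by blast
qed (simp add: free_group_on_def)


section \<open>Complex lines\<close>

definition is_complex_line :: "(complex \<times> complex) set \<Rightarrow> bool" where
  "is_complex_line l \<longleftrightarrow>
     (\<exists>a b c. (a, b) \<noteq> (0, 0) \<and> l = {(x, y). a * x + b * y + c = 0})"

definition line_direction :: "(complex \<times> complex) set \<Rightarrow> (complex \<times> complex) set" where
  "line_direction l = {p - q |p q. p \<in> l \<and> q \<in> l}"

definition parallel :: "(complex \<times> complex) set \<Rightarrow> (complex \<times> complex) set \<Rightarrow> bool" where
  "parallel l m \<longleftrightarrow> line_direction l = line_direction m"

lemma line_direction_eq:
  assumes "(a, b) \<noteq> (0, 0)"
  shows "line_direction {(x, y). a * x + b * y + c = 0} = {(u, v). a * u + b * v = 0}"
proof -
  obtain x0 y0 where 0: "a * x0 + b * y0 + c = 0"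
  proof (cases "a = 0")
    case True
    then show ?thesis
      using assms that [of 0 "- c / b"] by simp
  next
    case False
    then show ?thesis
      using that [of "- c / a" 0] by simp
  qed
  show ?thesis
  proof (intro equalityI subsetI)
    fix z assume "z \<in> line_direction {(x, y). a * x + b * y + c = 0}"
    then obtain x y x' y' where z: "z = (x - x', y - y')"
      and e: "a * x + b * y + c = 0" "a * x' + b * y' + c = 0"
      by (auto simp: line_direction_def)
    have "a * (x - x') + b * (y - y') = (a * x + b * y + c) - (a * x' + b * y' + c)"
      by (simp add: algebra_simps)
    then show "z \<in> {(u, v). a * u + b * v = 0}"
      using z e by simp
  next
    fix z assume "z \<in> {(u, v). a * u + b * v = 0}"
    then obtain u v where z: "z = (u, v)" and uv: "a * u + b * v = 0"
      by auto
    have "a * (x0 + u) + b * (y0 + v) + c = (a * x0 + b * y0 + c) + (a * u + b * v)"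
      by (simp add: algebra_simps)
    then have "a * (x0 + u) + b * (y0 + v) + c = 0"
      using 0 uv by simp
    moreover have "z = (x0 + u, y0 + v) - (x0, y0)"
      by (simp add: z)
    ultimately show "z \<in> line_direction {(x, y). a * x + b * y + c = 0}"
      unfolding line_direction_def using 0 by blast
  qed
qed

end

theory Submission
  imports Defs "HOL-Complex_Analysis.Winding_Numbers"
begin

text \<open>
  Two non-parallel lines meet in a point \<open>P\<close>, and near \<open>P\<close> the complement of the lines contains
  a torus both of whose parameter loops have the same winding number about the first line, but only
  one of which winds around the second. Hence the fundamental group contains commuting elements
  whose images under two homomorphisms to \<open>\<int>\<close> are linearly independent. In a free group this is
  impossible: two homomorphisms \<open>f\<close>, \<open>g\<close> to \<open>\<int>\<close> lift to a homomorphism to the Heisenberg group,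
  where elements over \<open>(x, y)\<close> and \<open>(x', y')\<close> commute only if \<open>x y' = x' y\<close>.
\<close>

section \<open>Commuting elements of a free group\<close>

text \<open>Complex values rather than integers, because the weights will come from winding numbers,
  which have type \<open>complex\<close>.\<close>

definition letter_value :: "('a \<Rightarrow> complex) \<Rightarrow> 'a letter \<Rightarrow> complex" where
  "letter_value f a = (if snd a then f (fst a) else - f (fst a))"

definition word_value :: "('a \<Rightarrow> complex) \<Rightarrow> 'a letter list \<Rightarrow> complex" where
  "word_value f w = (\<Sum>a\<leftarrow>w. letter_value f a)"

text \<open>
  The last coordinate of the homomorphism to the Heisenberg group, with multiplication
  \<open>(x, y, z) (x', y', z') = (x + x', y + y', z + z' + x y')\<close>, that sends a generator \<open>s\<close> to
  \<open>(f s, g s, 0)\<close>; note that \<open>(x, y, 0)\<close> has inverse \<open>(-x, -y, x y)\<close>.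
\<close>

fun heisenberg_value :: "('a \<Rightarrow> complex) \<Rightarrow> ('a \<Rightarrow> complex) \<Rightarrow> 'a letter list \<Rightarrow> complex" where
  "heisenberg_value f g [] = 0"
| "heisenberg_value f g (a # w) =
     (if snd a then 0 else f (fst a) * g (fst a))
       + heisenberg_value f g w + letter_value f a * word_value g w"

lemma word_value_simps [simp]:
  "word_value f [] = 0"
  "word_value f (a # w) = letter_value f a + word_value f w"
  "word_value f (u @ v) = word_value f u + word_value f v"
  by (simp_all add: word_value_def)

lemma letter_value_inv [simp]: "letter_value f (inv_letter a) = - letter_value f a"
  by (simp add: letter_value_def inv_letter_def)

lemma word_value_cancel_cons: "word_value f (cancel_cons a w) = word_value f (a # w)"
  by (cases w) auto

lemma word_value_reduce: "word_value f (reduce_word w) = word_value f w"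
  by (induction w) (simp_all add: reduce_word_def word_value_cancel_cons)

text \<open>The product added for an inverse letter is the last coordinate of the Heisenberg
  inverse; it cancels the cross term of an adjacent inverse pair.\<close>

lemma heisenberg_value_cancel_cons:
  "heisenberg_value f g (cancel_cons a w) = heisenberg_value f g (a # w)"
  by (cases w) (auto simp: letter_value_def inv_letter_def algebra_simps)

lemma heisenberg_value_reduce: "heisenberg_value f g (reduce_word w) = heisenberg_value f g w"
proof (induction w)
  case (Cons a w)
  have "reduce_word (a # w) = cancel_cons a (reduce_word w)"
    by (simp add: reduce_word_def)
  then show ?case
    using Cons by (simp add: heisenberg_value_cancel_cons word_value_reduce)
qed (simp add: reduce_word_def)

lemma heisenberg_value_append:
  "heisenberg_value f g (u @ v) =
     heisenberg_value f g u + heisenberg_value f g v + word_value f u * word_value g v"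
  by (induction u) (simp_all add: algebra_simps)

text \<open>Both orders give the same last Heisenberg coordinate. Its symmetric part drops out,
  leaving the two cross terms.\<close>

lemma word_value_commute:
  assumes "reduce_word (u @ v) = reduce_word (v @ u)"
  shows "word_value f u * word_value g v = word_value f v * word_value g u"
proof -
  have "heisenberg_value f g (u @ v) = heisenberg_value f g (v @ u)"
    using assms by (metis heisenberg_value_reduce)
  then show ?thesis
    by (simp add: heisenberg_value_append)
qed

section \<open>Additive maps on free groups\<close>

text \<open>Induction on the word: a reduced word \<open>a # w\<close> is the product of
  \<open>[a]\<close> and \<open>w\<close> without cancellation, and additivity forces opposite
  values on a letter and its inverse.\<close>

lemma additive_on_free_group:
  fixes \<phi> :: "'a letter list \<Rightarrow> complex"
  assumes add: "\<And>u v. u \<in> carrier (free_group_on S) \<Longrightarrow> v \<in> carrier (free_group_on S) \<Longrightarrow>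
      \<phi> (u \<otimes>\<^bsub>free_group_on S\<^esub> v) = \<phi> u + \<phi> v"
    and w: "w \<in> carrier (free_group_on S)"
  shows "\<phi> w = word_value (\<lambda>s. \<phi> [(s, True)]) w"
  using w
proof (induction w)
  case Nil
  then show ?case
    using add [of "[]" "[]"] by (simp add: free_group_on_def reduce_word_def)
next
  case (Cons a w)
  have w: "w \<in> carrier (free_group_on S)" and s: "fst a \<in> S"
    using Cons.prems by (auto simp: free_group_on_def dest: reduced_word_ConsD)
  have letter: "[(fst a, b)] \<in> carrier (free_group_on S)" for b
    using s by (simp add: free_group_on_def reduced_word_def)
  have nil: "\<phi> [] = 0"
    using add [of "[]" "[]"] by (simp add: free_group_on_def reduce_word_def)
  have "\<phi> [(fst a, True)] + \<phi> [(fst a, False)] = 0"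
    using add [OF letter [of True] letter [of False]] nil
    by (simp add: free_group_on_def reduce_word_def inv_letter_def)
  then have "\<phi> [a] = letter_value (\<lambda>s. \<phi> [(s, True)]) a"
    by (cases a; cases "snd a") (auto simp: letter_value_def add_eq_0_iff)
  moreover have "[a] \<otimes>\<^bsub>free_group_on S\<^esub> w = a # w"
    using Cons.prems reduce_word_reduced [of "a # w"] by (simp add: free_group_on_def)
  moreover have "[a] \<in> carrier (free_group_on S)"
    using letter [of "snd a"] by simp
  ultimately show ?case
    using add [of "[a]" w] w Cons.IH by simp
qed

lemma free_group_commute_imp_dependent:
  fixes \<phi> \<psi> :: "'a \<Rightarrow> complex"
  assumes free: "is_free_group G"
    and \<phi>: "\<And>x y. x \<in> carrier G \<Longrightarrow> y \<in> carrier G \<Longrightarrow> \<phi> (x \<otimes>\<^bsub>G\<^esub> y) = \<phi> x + \<phi> y"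
    and \<psi>: "\<And>x y. x \<in> carrier G \<Longrightarrow> y \<in> carrier G \<Longrightarrow> \<psi> (x \<otimes>\<^bsub>G\<^esub> y) = \<psi> x + \<psi> y"
    and xy: "x \<in> carrier G" "y \<in> carrier G" and comm: "x \<otimes>\<^bsub>G\<^esub> y = y \<otimes>\<^bsub>G\<^esub> x"
  shows "\<phi> x * \<psi> y = \<phi> y * \<psi> x"
proof -
  obtain S :: "'a set" and h where h: "h \<in> iso (free_group_on S) G"
    using free by (auto simp: is_free_group_def is_iso_def)
  let ?F = "free_group_on S"
  interpret F: group ?F
    by (rule group_free_group_on)
  have bij: "bij_betw h (carrier ?F) (carrier G)" and hom: "h \<in> hom ?F G"
    using h by (auto simp: iso_def)
  have "x \<in> h ` carrier ?F" "y \<in> h ` carrier ?F"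
    using bij xy by (simp_all add: bij_betw_imp_surj_on)
  then obtain u v where u: "u \<in> carrier ?F" "h u = x" and v: "v \<in> carrier ?F" "h v = y"
    by blast
  have "h (u \<otimes>\<^bsub>?F\<^esub> v) = h (v \<otimes>\<^bsub>?F\<^esub> u)"
    using comm u v hom by (simp add: hom_mult)
  then have "u \<otimes>\<^bsub>?F\<^esub> v = v \<otimes>\<^bsub>?F\<^esub> u"
    using bij u v by (meson F.m_closed bij_betw_imp_inj_on inj_onD)
  then have red: "reduce_word (u @ v) = reduce_word (v @ u)"
    by (simp add: free_group_on_def)
  \<comment> \<open>Stated for an arbitrary additive \<open>\<theta>\<close>, so that the same
    pullback along \<open>h\<close> serves both \<open>\<phi>\<close> and
    \<open>\<psi>\<close>.\<close>
  have "\<exists>f. \<forall>w \<in> carrier ?F. \<theta> (h w) = word_value f w"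
    if "\<And>x y. x \<in> carrier G \<Longrightarrow> y \<in> carrier G \<Longrightarrow> \<theta> (x \<otimes>\<^bsub>G\<^esub> y) = \<theta> x + \<theta> y"
    for \<theta> :: "'a \<Rightarrow> complex"
  proof -
    have "(\<theta> \<circ> h) (u \<otimes>\<^bsub>?F\<^esub> v) = (\<theta> \<circ> h) u + (\<theta> \<circ> h) v"
      if "u \<in> carrier ?F" "v \<in> carrier ?F" for u v
      using that hom \<open>\<And>x y. x \<in> carrier G \<Longrightarrow> y \<in> carrier G \<Longrightarrow> \<theta> (x \<otimes>\<^bsub>G\<^esub> y) = \<theta> x + \<theta> y\<close>
      by (simp add: hom_mult hom_in_carrier)
    from additive_on_free_group [of S "\<theta> \<circ> h", OF this] show ?thesis
      by auto
  qed
  from this [OF \<phi>] this [OF \<psi>] show ?thesis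
    using u v word_value_commute [OF red] by metis
qed


section \<open>Winding numbers as homomorphisms on the fundamental group\<close>

lemma winding_number_compose_homotopic:
  assumes "homotopic_paths S p q" "continuous_on S f" "f ` S \<subseteq> - {0::complex}"
  shows "winding_number (f \<circ> p) 0 = winding_number (f \<circ> q) 0"
proof (rule winding_number_homotopic_paths)
  show "homotopic_paths (- {0}) (f \<circ> p) (f \<circ> q)"
    using assms by (intro homotopic_paths_continuous_image) auto
qed

lemma winding_number_compose_join:
  assumes "path p" "path q" "path_image p \<subseteq> S" "path_image q \<subseteq> S" "pathfinish p = pathstart q"
    and f: "continuous_on S f" "f ` S \<subseteq> - {0::complex}"
  shows "winding_number (f \<circ> (p +++ q)) 0 = winding_number (f \<circ> p) 0 + winding_number (f \<circ> q) 0"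
proof -
  have "path (f \<circ> p)" "path (f \<circ> q)"
    using assms by (auto intro!: path_continuous_image intro: continuous_on_subset)
  moreover have "0 \<notin> path_image (f \<circ> p)" "0 \<notin> path_image (f \<circ> q)"
    using assms by (auto simp: path_image_compose)
  ultimately show ?thesis
    using assms(5) by (simp add: path_compose_join winding_number_join pathfinish_compose pathstart_compose)
qed

text \<open>The contributions of \<open>\<gamma>\<close> and of its reverse cancel, so a change of
  base point preserves winding numbers.\<close>

lemma winding_number_compose_conjugate:
  assumes "path \<gamma>" "path_image \<gamma> \<subseteq> S" "pathfinish \<gamma> = y" and p: "p \<in> loops_at S y"
    and f: "continuous_on S f" "f ` S \<subseteq> - {0::complex}"
  shows "winding_number (f \<circ> (\<gamma> +++ p +++ reversepath \<gamma>)) 0 = winding_number (f \<circ> p) 0"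
proof -
  have "path (f \<circ> \<gamma>)" "0 \<notin> path_image (f \<circ> \<gamma>)"
    using assms by (auto simp: path_image_compose intro!: path_continuous_image
        intro: continuous_on_subset)
  then have "winding_number (f \<circ> reversepath \<gamma>) 0 = - winding_number (f \<circ> \<gamma>) 0"
    by (simp add: path_compose_reversepath winding_number_reversepath)
  moreover have "winding_number (f \<circ> (\<gamma> +++ p +++ reversepath \<gamma>)) 0 =
      winding_number (f \<circ> \<gamma>) 0 + winding_number (f \<circ> (p +++ reversepath \<gamma>)) 0"
    using assms by (intro winding_number_compose_join [OF _ _ _ _ _ f])
      (auto simp: loops_at_def path_image_join)
  moreover have "winding_number (f \<circ> (p +++ reversepath \<gamma>)) 0 =
      winding_number (f \<circ> p) 0 + winding_number (f \<circ> reversepath \<gamma>) 0"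
    using assms by (intro winding_number_compose_join [OF _ _ _ _ _ f]) (auto simp: loops_at_def)
  ultimately show ?thesis
    by simp
qed

lemma free_fundamental_group_commute:
  fixes S :: "'a::real_normed_vector set"
  assumes free: "is_free_group (fundamental_group S x)"
    and p: "p \<in> loops_at S x" and q: "q \<in> loops_at S x"
    and comm: "homotopic_paths S (p +++ q) (q +++ p)"
    and f: "continuous_on S f" "f ` S \<subseteq> - {0::complex}"
    and g: "continuous_on S g" "g ` S \<subseteq> - {0::complex}"
  shows "winding_number (f \<circ> p) 0 * winding_number (g \<circ> q) 0 =
         winding_number (f \<circ> q) 0 * winding_number (g \<circ> p) 0"
proof -
  let ?G = "fundamental_group S x"
  \<comment> \<open>The choice of a representative is harmless: for continuous \<open>h\<close>
    without zeros on \<open>S\<close>, homotopic loops have the same winding number after applying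
    \<open>h\<close>.\<close>
  define W where "W h A = winding_number (h \<circ> (SOME r. r \<in> A)) 0"
    for h :: "'a \<Rightarrow> complex" and A
  have car: "carrier ?G = path_class S ` loops_at S x"
    by (simp add: fundamental_group_def)
  have join: "r +++ s \<in> loops_at S x" if "r \<in> loops_at S x" "s \<in> loops_at S x" for r s
    using that by (auto simp: loops_at_def path_image_join)
  have W: "W h (path_class S r) = winding_number (h \<circ> r) 0"
    if "continuous_on S h" "h ` S \<subseteq> - {0}" "r \<in> loops_at S x" for h r
  proof -
    have "r \<in> path_class S r"
      using that by (auto simp: path_class_def loops_at_def)
    then have "(SOME s. s \<in> path_class S r) \<in> path_class S r"
      by (rule someI [of "\<lambda>s. s \<in> path_class S r"])
    then have "homotopic_paths S r (SOME s. s \<in> path_class S r)"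
      by (simp add: path_class_def)
    from winding_number_compose_homotopic [OF this that(1,2)] show ?thesis
      by (simp add: W_def)
  qed
  have add: "W h (A \<otimes>\<^bsub>?G\<^esub> B) = W h A + W h B"
    if h: "continuous_on S h" "h ` S \<subseteq> - {0}" and AB: "A \<in> carrier ?G" "B \<in> carrier ?G" for h A B
  proof -
    obtain r s where r: "r \<in> loops_at S x" "A = path_class S r"
      and s: "s \<in> loops_at S x" "B = path_class S s"
      using AB unfolding car by blast
    then show ?thesis
      using h by (simp add: fundamental_group_mult W join)
        (rule winding_number_compose_join, auto simp: loops_at_def)
  qed
  have "path_class S p \<otimes>\<^bsub>?G\<^esub> path_class S q = path_class S q \<otimes>\<^bsub>?G\<^esub> path_class S p"
    using comm by (simp add: fundamental_group_mult p q path_class_eq_iff [OF join])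
  moreover have "path_class S p \<in> carrier ?G" "path_class S q \<in> carrier ?G"
    using p q car by auto
  ultimately show ?thesis
    using free_group_commute_imp_dependent [OF free add [OF f] add [OF g],
        of "path_class S p" "path_class S q"]
    by (simp only: W [OF f p] W [OF f q] W [OF g p] W [OF g q])
qed

section \<open>Change of base point\<close>

text \<open>Reassociate until \<open>reversepath \<gamma> +++ \<gamma>\<close> stands alone in the
  middle, then contract it to the constant path at \<open>y\<close>.\<close>

lemma homotopic_paths_conjugate_join:
  fixes S :: "'a::real_normed_vector set"
  assumes \<gamma>: "path \<gamma>" "path_image \<gamma> \<subseteq> S" "pathfinish \<gamma> = y"
    and p: "p \<in> loops_at S y" and q: "q \<in> loops_at S y"
  shows "homotopic_paths S ((\<gamma> +++ p +++ reversepath \<gamma>) +++ (\<gamma> +++ q +++ reversepath \<gamma>))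
           (\<gamma> +++ (p +++ q) +++ reversepath \<gamma>)"
proof -
  let ?r = "reversepath \<gamma>"
  let ?q = "q +++ ?r"
  note [simp] = path_image_join
  have facts: "path p" "path_image p \<subseteq> S" "pathstart p = y" "pathfinish p = y"
    "path q" "path_image q \<subseteq> S" "pathstart q = y" "pathfinish q = y"
    using p q by (auto simp: loops_at_def)
  note [simp] = facts \<gamma>
  have 1: "homotopic_paths S ((\<gamma> +++ p +++ ?r) +++ (\<gamma> +++ ?q)) (\<gamma> +++ (p +++ ?r) +++ (\<gamma> +++ ?q))"
    by (rule homotopic_paths_sym, rule homotopic_paths_assoc) auto
  have 2: "homotopic_paths S ((p +++ ?r) +++ (\<gamma> +++ ?q)) (p +++ ?r +++ (\<gamma> +++ ?q))"
    by (rule homotopic_paths_sym, rule homotopic_paths_assoc) auto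
  have "homotopic_paths S (?r +++ (\<gamma> +++ ?q)) ((?r +++ \<gamma>) +++ ?q)"
    by (rule homotopic_paths_assoc) auto
  also have "homotopic_paths S \<dots> (linepath y y +++ ?q)"
    by (rule homotopic_paths_join)
      (use homotopic_paths_linv [of \<gamma> S] in auto)
  also have "homotopic_paths S \<dots> ?q"
    using homotopic_paths_lid [of ?q S] by simp
  finally have 3: "homotopic_paths S (?r +++ (\<gamma> +++ ?q)) ?q" .
  have 4: "homotopic_paths S (p +++ ?r +++ (\<gamma> +++ ?q)) (p +++ ?q)"
    by (rule homotopic_paths_join) (use 3 in auto)
  have 5: "homotopic_paths S (p +++ ?q) ((p +++ q) +++ ?r)"
    by (rule homotopic_paths_assoc) auto
  have "homotopic_paths S (\<gamma> +++ (p +++ ?r) +++ (\<gamma> +++ ?q)) (\<gamma> +++ (p +++ q) +++ ?r)"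
    by (rule homotopic_paths_join)
      (use homotopic_paths_trans [OF 2 homotopic_paths_trans [OF 4 5]] in auto)
  with 1 show ?thesis
    by (rule homotopic_paths_trans)
qed

text \<open>The commuting loops will lie on a torus through \<open>y\<close>, while freeness is
  known at \<open>x\<close>. Conjugation by a path from \<open>x\<close> to \<open>y\<close> carries
  the relation over and keeps the winding numbers.\<close>

lemma free_fundamental_group_commute_free_base:
  fixes S :: "'a::real_normed_vector set"
  assumes free: "is_free_group (fundamental_group S x)"
    and xy: "path_component S x y"
    and p: "p \<in> loops_at S y" and q: "q \<in> loops_at S y"
    and comm: "homotopic_paths S (p +++ q) (q +++ p)"
    and f: "continuous_on S f" "f ` S \<subseteq> - {0::complex}"
    and g: "continuous_on S g" "g ` S \<subseteq> - {0::complex}"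
  shows "winding_number (f \<circ> p) 0 * winding_number (g \<circ> q) 0 =
         winding_number (f \<circ> q) 0 * winding_number (g \<circ> p) 0"
proof -
  obtain \<gamma> where \<gamma>: "path \<gamma>" "path_image \<gamma> \<subseteq> S" "pathstart \<gamma> = x" "pathfinish \<gamma> = y"
    using xy by (auto simp: path_component_def)
  define C where "C r = \<gamma> +++ r +++ reversepath \<gamma>" for r
  have C: "C r \<in> loops_at S x" if "r \<in> loops_at S y" for r
    using that \<gamma> by (auto simp: C_def loops_at_def path_image_join)
  have "homotopic_paths S (C (p +++ q)) (C (q +++ p))"
    unfolding C_def
  proof (rule homotopic_paths_join)
    show "homotopic_paths S ((p +++ q) +++ reversepath \<gamma>) ((q +++ p) +++ reversepath \<gamma>)"
      by (rule homotopic_paths_join [OF comm]) (use \<gamma> q in \<open>auto simp: loops_at_def\<close>)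
  qed (use \<gamma> p in \<open>auto simp: loops_at_def\<close>)
  then have "homotopic_paths S (C p +++ C q) (C q +++ C p)"
    using homotopic_paths_conjugate_join [OF \<gamma>(1,2,4)] p q
    unfolding C_def by (meson homotopic_paths_trans homotopic_paths_sym)
  from free_fundamental_group_commute [OF free C [OF p] C [OF q] this f g]
  show ?thesis
    unfolding C_def using winding_number_compose_conjugate [OF \<gamma>(1,2,4)] p q f g by simp
qed

section \<open>Commuting loops on a torus\<close>

lemma torus_loops_commute:
  fixes T :: "real \<times> real \<Rightarrow> 'a::real_normed_vector"
  assumes cont: "continuous_on UNIV T" and im: "range T \<subseteq> S"
    and per: "\<And>s. T (s, 1) = T (s, 0)" "\<And>t. T (1, t) = T (0, t)"
  defines "p \<equiv> \<lambda>s. T (s, 0)" and "q \<equiv> \<lambda>t. T (0, t)"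
  shows "p \<in> loops_at S (T (0, 0))" "q \<in> loops_at S (T (0, 0))"
    "homotopic_paths S (p +++ q) (q +++ p)"
proof -
  have "continuous_on A p" "continuous_on A q" for A
    unfolding p_def q_def
    by (auto intro!: continuous_on_compose2 [OF cont] continuous_intros)
  then show "p \<in> loops_at S (T (0, 0))" "q \<in> loops_at S (T (0, 0))"
    using im per by (auto simp: loops_at_def path_def path_image_def pathstart_def pathfinish_def
        p_def q_def)
  \<comment> \<open>The two ways around the unit square between opposite corners, homotopic because
    the plane is convex.\<close>
  let ?P = "linepath (0, 0) (1, 0) +++ linepath (1, 0) (1, 1 :: real) :: real \<Rightarrow> real \<times> real"
  let ?Q = "linepath (0, 0) (0, 1) +++ linepath (0, 1) (1, 1 :: real) :: real \<Rightarrow> real \<times> real"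
  have "homotopic_paths UNIV ?P ?Q"
    by (rule homotopic_paths_linear) auto
  then have "homotopic_paths S (T \<circ> ?P) (T \<circ> ?Q)"
    using cont im by (rule_tac homotopic_paths_continuous_image) auto
  \<comment> \<open>Periodicity turns the right and top edges into copies of \<open>q\<close> and
    \<open>p\<close>.\<close>
  moreover have "T \<circ> ?P = p +++ q" "T \<circ> ?Q = q +++ p"
    using per by (auto simp: fun_eq_iff joinpaths_def linepath_def p_def q_def)
  ultimately show "homotopic_paths S (p +++ q) (q +++ p)"
    by simp
qed


section \<open>Complements of line arrangements\<close>

text \<open>Along the complex affine parametrisation \<open>g\<close> from \<open>x\<close> to
  \<open>y\<close>, each form is a polynomial of degree at most one that is nonzero at 0. So
  finitely many parameters are forbidden, and the complex plane without them is path
  connected.\<close>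

lemma path_component_complement_lines:
  fixes a b c :: "'i \<Rightarrow> complex"
  assumes "finite I"
    and x: "\<And>k. k \<in> I \<Longrightarrow> a k * fst x + b k * snd x + c k \<noteq> 0"
    and y: "\<And>k. k \<in> I \<Longrightarrow> a k * fst y + b k * snd y + c k \<noteq> 0"
  shows "path_component {z. \<forall>k\<in>I. a k * fst z + b k * snd z + c k \<noteq> 0} x y"
    (is "path_component ?S x y")
proof -
  define g where "g z = (fst x + z * (fst y - fst x), snd x + z * (snd y - snd x))" for z
  let ?A = "{z. g z \<notin> ?S}"
  have "finite {z. a k * fst (g z) + b k * snd (g z) + c k = 0}" if "k \<in> I" for k
  proof (rule finite_subset)
    define u v where "u = a k * fst x + b k * snd x + c k"
      and "v = a k * (fst y - fst x) + b k * (snd y - snd x)"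
    have "a k * fst (g z) + b k * snd (g z) + c k = u + z * v" for z
      by (simp add: g_def u_def v_def algebra_simps)
    moreover have "u \<noteq> 0"
      using x that by (simp add: u_def)
    \<comment> \<open>If \<open>v = 0\<close>, the form is the nonzero constant \<open>u\<close> and
      the set is empty.\<close>
    ultimately show "{z. a k * fst (g z) + b k * snd (g z) + c k = 0} \<subseteq> {- u / v}"
      by (cases "v = 0") (auto simp: eq_divide_eq add_eq_0_iff2 add.commute)
  qed simp
  moreover have "?A = (\<Union>k\<in>I. {z. a k * fst (g z) + b k * snd (g z) + c k = 0})"
    by auto
  ultimately have "finite ?A"
    using \<open>finite I\<close> by simp
  then have "path_connected (- ?A)"
    by (intro path_connected_complement_countable) (auto simp: countable_finite)
  then have "path_connected (g ` (- ?A))"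
    by (rule path_connected_continuous_image [rotated]) (auto simp: g_def intro!: continuous_intros)
  moreover have "g 0 = x" "g 1 = y"
    by (simp_all add: g_def)
  then have "x \<in> g ` (- ?A)" "y \<in> g ` (- ?A)"
    using x y by (auto intro: rev_image_eqI [of 0] rev_image_eqI [of 1])
  ultimately have "path_component (g ` (- ?A)) x y"
    unfolding path_connected_component by blast
  moreover have "g ` (- ?A) \<subseteq> ?S"
    by auto
  ultimately show ?thesis
    by (rule path_component_of_subset [rotated])
qed

section \<open>Coefficients of parallel lines\<close>

lemma parallelI:
  assumes ab: "(a, b) \<noteq> (0, 0)" "(a', b') \<noteq> (0, 0)" and det: "a * b' = a' * b"
  shows "parallel {(x, y). a * x + b * y + c = 0} {(x, y). a' * x + b' * y + c' = 0}"
proof -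
  \<comment> \<open>Proved for arbitrary coefficients, so that exchanging the lines gives the other
    inclusion. Multiplying by both \<open>a\<close> and \<open>b\<close> avoids deciding which is
    nonzero.\<close>
  have "a' * u + b' * v = 0"
    if "(a, b) \<noteq> (0, 0)" "a * b' = a' * b" "a * u + b * v = 0" for a b a' b' u v :: complex
  proof -
    have "a * (a' * u + b' * v) = 0"
      using that(2,3) by algebra
    moreover have "b * (a' * u + b' * v) = 0"
      using that(2,3) by algebra
    ultimately show ?thesis
      using that(1) by auto
  qed
  from this [of a b b' a'] this [of a' b' b a] show ?thesis
    unfolding parallel_def line_direction_eq [OF ab(1)] line_direction_eq [OF ab(2)]
    using ab det by auto
qed

lemma parallel_meet_imp_eq:
  assumes ab: "(a, b) \<noteq> (0, 0)" "(a', b') \<noteq> (0, 0)" and det: "a * b' = a' * b"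
    and "a * u + b * v + c = 0" "a' * u + b' * v + c' = (0::complex)"
  shows "{(x, y). a * x + b * y + c = 0} = {(x, y). a' * x + b' * y + c' = 0}"
proof -
  have "a' * x + b' * y + c' = 0"
    if "(a, b) \<noteq> (0, 0)" "a * b' = a' * b" "a * u + b * v + c = 0" "a' * u + b' * v + c' = 0"
      "a * x + b * y + c = 0" for a b c a' b' c' x y :: complex
  proof -
    have "a * (a' * x + b' * y + c') = 0"
      using that(2-5) by algebra
    moreover have "b * (a' * x + b' * y + c') = 0"
      using that(2-5) by algebra
    ultimately show ?thesis
      using that(1) by auto
  qed
  from this [of a b b' a' c c'] this [of a' b' b a c' c]
  have "a * x + b * y + c = 0 \<longleftrightarrow> a' * x + b' * y + c' = 0" for x y
    using assms by metis
  then show ?thesis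
    by simp
qed

section \<open>A torus near the meeting point of two lines\<close>

lemma winding_number_rotation:
  assumes "r \<noteq> 0"
  shows "winding_number (\<lambda>t. r * exp (2 * of_real pi * \<i> * of_real t)) 0 = 1"
proof -
  \<comment> \<open>The circle is the exponential of a segment with displacement 2 pi i, and its
    winding number is that displacement divided by 2 pi i.\<close>
  have "(\<lambda>t. r * exp (2 * of_real pi * \<i> * of_real t)) = exp \<circ> linepath (Ln r) (Ln r + 2 * of_real pi * \<i>)"
  proof
    fix t
    have "linepath (Ln r) (Ln r + 2 * of_real pi * \<i>) t = Ln r + 2 * of_real pi * \<i> * of_real t"
      by (simp add: linepath_def scaleR_conv_of_real algebra_simps)
    then show "r * exp (2 * of_real pi * \<i> * of_real t) = (exp \<circ> linepath (Ln r) (Ln r + 2 * of_real pi * \<i>)) t"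
      using assms by (simp add: exp_add)
  qed
  then show ?thesis
    by (simp add: winding_number_compose_exp)
qed

text \<open>Think of \<open>l k\<close> as the value of an affine form at the centre, and of
  \<open>A k\<close>, \<open>B k\<close> as its linear part on two directions. First
  \<open>\<epsilon>\<close> is chosen so that the \<open>B\<close> term cannot cancel a nonzero
  \<open>A k\<close>; then \<open>\<rho>\<close>, depending on \<open>\<epsilon>\<close>, is so
  small that a nonzero \<open>l k\<close> dominates.\<close>

lemma exists_torus_radii:
  fixes l A B :: "'i \<Rightarrow> complex"
  assumes "finite I" and nz: "\<And>k. k \<in> I \<Longrightarrow> l k = 0 \<Longrightarrow> A k \<noteq> 0 \<or> B k \<noteq> 0"
  shows "\<exists>\<rho>>0. \<exists>\<epsilon>>0. \<forall>k\<in>I. \<forall>u w. norm u = 1 \<longrightarrow> norm w = 1 \<longrightarrow>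
    l k + of_real \<rho> * u * (A k + of_real \<epsilon> * w * B k) \<noteq> 0"
proof -
  \<comment> \<open>The guard \<open>d \<noteq> 0\<close> lets the bound apply to every index;
    finitely many such conditions hold together near 0.\<close>
  have small: "\<forall>\<^sub>F r in at_right (0::real). d \<noteq> 0 \<longrightarrow> r * c < norm d" for c and d :: complex
  proof (cases "d = 0")
    case False
    have "((\<lambda>r. r * c) \<longlongrightarrow> 0 * c) (at_right 0)"
      by (intro tendsto_intros)
    then have "\<forall>\<^sub>F r in at_right 0. r * c < norm d"
      using False by (intro order_tendstoD(2)) auto
    then show ?thesis
      by (rule eventually_mono) simp
  qed simp
  have "\<forall>\<^sub>F \<epsilon> in at_right 0. \<epsilon> > 0 \<and> (\<forall>k\<in>I. A k \<noteq> 0 \<longrightarrow> \<epsilon> * norm (B k) < norm (A k))"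
    using \<open>finite I\<close> by (intro eventually_conj eventually_at_right_less eventually_ball_finite ballI small)
  from eventually_happens' [OF trivial_limit_at_right_real this] obtain \<epsilon>
    where \<epsilon>: "\<epsilon> > 0" "\<And>k. k \<in> I \<Longrightarrow> A k \<noteq> 0 \<Longrightarrow> \<epsilon> * norm (B k) < norm (A k)"
    by blast
  have "\<forall>\<^sub>F \<rho> in at_right 0. \<rho> > 0 \<and>
      (\<forall>k\<in>I. l k \<noteq> 0 \<longrightarrow> \<rho> * (norm (A k) + \<epsilon> * norm (B k)) < norm (l k))"
    using \<open>finite I\<close> by (intro eventually_conj eventually_at_right_less eventually_ball_finite ballI small)
  from eventually_happens' [OF trivial_limit_at_right_real this] obtain \<rho>
    where \<rho>: "\<rho> > 0" "\<And>k. k \<in> I \<Longrightarrow> l k \<noteq> 0 \<Longrightarrow> \<rho> * (norm (A k) + \<epsilon> * norm (B k)) < norm (l k)"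
    by blast
  have "l k + of_real \<rho> * u * (A k + of_real \<epsilon> * w * B k) \<noteq> 0"
    if k: "k \<in> I" and u: "norm u = 1" and w: "norm w = 1" for k u w
  proof
    assume eq: "l k + of_real \<rho> * u * (A k + of_real \<epsilon> * w * B k) = 0"
    have wB: "norm (of_real \<epsilon> * w * B k) = \<epsilon> * norm (B k)"
      using \<epsilon>(1) w by (simp add: norm_mult)
    show False
    proof (cases "l k = 0")
      case True
      moreover have "u \<noteq> 0" "w \<noteq> 0"
        using u w by auto
      ultimately have 0: "A k + of_real \<epsilon> * w * B k = 0"
        using eq \<rho>(1) by simp
      then have "norm (A k) = \<epsilon> * norm (B k)"
        using wB by (metis add_eq_0_iff norm_minus_cancel)
      then have "A k = 0"
        using \<epsilon>(2) [OF k] by fastforce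
      then show False
        using nz [OF k True] 0 \<epsilon>(1) \<open>w \<noteq> 0\<close> by simp
    next
      case False
      have "norm (l k) = \<rho> * norm (A k + of_real \<epsilon> * w * B k)"
        using eq u \<rho>(1) by (simp add: add_eq_0_iff2 norm_mult)
      also have "\<dots> \<le> \<rho> * (norm (A k) + \<epsilon> * norm (B k))"
        using \<rho>(1) wB by (metis norm_triangle_ineq mult_left_mono less_imp_le)
      finally show False
        using \<rho>(2) [OF k False] by simp
    qed
  qed
  with \<open>\<rho> > 0\<close> \<open>\<epsilon> > 0\<close> show ?thesis
    by blast
qed

text \<open>The hypothesis \<open>meet\<close> makes \<open>A k\<close> nonzero for every line other
  than \<open>i\<close> through the centre of the torus, as the choice of radii requires.\<close>

lemma fundamental_group_two_slopes_not_free: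
  fixes a b c :: "'i \<Rightarrow> complex" and I :: "'i set"
  defines "S \<equiv> {z. \<forall>k\<in>I. a k * fst z + b k * snd z + c k \<noteq> 0}"
  assumes "finite I" and ij: "i \<in> I" "j \<in> I" and det: "a i * b j \<noteq> a j * b i" and x: "x \<in> S"
    and meet: "\<And>k u v. k \<in> I \<Longrightarrow> k \<noteq> i \<Longrightarrow> a k * u + b k * v + c k = 0 \<Longrightarrow>
      a i * u + b i * v + c i = 0 \<Longrightarrow> a k * b i \<noteq> a i * b k"
  shows "\<not> is_free_group (fundamental_group S x)"
proof
  assume free: "is_free_group (fundamental_group S x)"
  define \<l> where "\<l> k z = a k * fst z + b k * snd z + c k" for k and z :: "complex \<times> complex"
  define D where "D = a i * b j - a j * b i"
  have D: "D \<noteq> 0"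
    using det by (simp add: D_def)
  \<comment> \<open>Cramer's rule for the common point of lines \<open>i\<close> and
    \<open>j\<close>.\<close>
  define P where "P = ((b i * c j - b j * c i) / D, (c i * a j - c j * a i) / D)"
  have Pi: "\<l> i P = 0" and Pj: "\<l> j P = 0"
    using D by (simp_all add: \<l>_def P_def divide_simps) (simp_all add: D_def algebra_simps)
  \<comment> \<open>The linear part of \<open>\<l> k\<close> on the direction vectors
    \<open>(b i, - a i)\<close> and \<open>(b j, - a j)\<close>.\<close>
  define A B where "A k = a k * b i - b k * a i" and "B k = a k * b j - b k * a j" for k
  have AB: "A i = 0" "B i = D" "A j = - D" "B j = 0"
    by (simp_all add: A_def B_def D_def algebra_simps)
  have AB_nz: "A k \<noteq> 0 \<or> B k \<noteq> 0" if "k \<in> I" "\<l> k P = 0" for k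
    using meet [of k "fst P" "snd P"] that Pi AB D by (cases "k = i") (auto simp: \<l>_def A_def)
  obtain \<rho> \<epsilon> :: real where pos: "\<rho> > 0" "\<epsilon> > 0"
    and nz: "\<And>k u w. k \<in> I \<Longrightarrow> norm u = 1 \<Longrightarrow> norm w = 1 \<Longrightarrow>
       \<l> k P + of_real \<rho> * u * (A k + of_real \<epsilon> * w * B k) \<noteq> 0"
    using exists_torus_radii [of I "\<lambda>k. \<l> k P" A B, OF \<open>finite I\<close> AB_nz] by blast
  define e where "e t = exp (2 * of_real pi * \<i> * of_real t)" for t :: real
  have e: "norm (e t) = 1" "e 0 = 1" "e 1 = 1" for t
    by (simp_all add: e_def norm_exp_eq_Re exp_eq_1)
  have cont_e [continuous_intros]: "continuous_on X (\<lambda>x. e (f x))" if "continuous_on X f"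
    for X :: "(real \<times> real) set" and f
    unfolding e_def by (intro continuous_intros that)
  text \<open>
    The directions of the lines \<open>i\<close> and \<open>j\<close> are \<open>(b i, - a i)\<close> and \<open>(b j, - a j)\<close>: the torus
    is \<open>P + \<rho> e(s) ((b i, - a i) + \<epsilon> e(t) (b j, - a j))\<close>.
  \<close>
  define T where "T = (\<lambda>(s, t). (fst P + \<rho> * e s * (b i + \<epsilon> * e t * b j),
      snd P - \<rho> * e s * (a i + \<epsilon> * e t * a j)))"
  \<comment> \<open>This is the expression that the choice of radii keeps away from 0.\<close>
  have \<l>T: "\<l> k (T (s, t)) = \<l> k P + \<rho> * e s * (A k + \<epsilon> * e t * B k)" for k s t
    by (simp add: \<l>_def T_def A_def B_def algebra_simps)
  have "continuous_on UNIV T"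
    unfolding T_def case_prod_beta by (intro continuous_intros)
  moreover have range: "range T \<subseteq> S"
    using nz e by (auto simp: S_def \<l>T simp flip: \<l>_def)
  moreover have "T (s, 1) = T (s, 0)" "T (1, s) = T (0, s)" for s
    by (simp_all add: T_def e)
  ultimately have loops: "(\<lambda>s. T (s, 0)) \<in> loops_at S (T (0, 0))" "(\<lambda>t. T (0, t)) \<in> loops_at S (T (0, 0))"
    "homotopic_paths S ((\<lambda>s. T (s, 0)) +++ (\<lambda>t. T (0, t))) ((\<lambda>t. T (0, t)) +++ (\<lambda>s. T (s, 0)))"
    by (rule torus_loops_commute)+
  have "T (0, 0) \<in> S"
    using range by auto
  then have "path_component S x (T (0, 0))"
    using x path_component_complement_lines [OF \<open>finite I\<close>, of a x b c "T (0, 0)"]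
    by (simp add: S_def)
  moreover have "continuous_on S (\<l> k)" for k
    unfolding \<l>_def by (intro continuous_intros)
  moreover have "\<l> k ` S \<subseteq> - {0}" if "k \<in> I" for k
    using that by (auto simp: S_def \<l>_def)
  ultimately have eq: "winding_number (\<l> i \<circ> (\<lambda>s. T (s, 0))) 0 * winding_number (\<l> j \<circ> (\<lambda>t. T (0, t))) 0 =
      winding_number (\<l> i \<circ> (\<lambda>t. T (0, t))) 0 * winding_number (\<l> j \<circ> (\<lambda>s. T (s, 0))) 0"
    using free_fundamental_group_commute_free_base [OF free _ loops] ij by blast
  have rot: "winding_number (\<lambda>t. r * e t) 0 = 1" if "r \<noteq> 0" for r
    unfolding e_def using winding_number_rotation [OF that] .
  \<comment> \<open>Moving in the direction of line \<open>j\<close> leaves \<open>\<l> j\<close>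
    constant, so the \<open>t\<close> loop has winding number 0 there; the other two composites are
    circles about 0. Thus \<open>eq\<close> becomes 0 = 1.\<close>
  have "\<l> i \<circ> (\<lambda>t. T (0, t)) = (\<lambda>t. (\<rho> * \<epsilon> * D) * e t)"
    "\<l> j \<circ> (\<lambda>s. T (s, 0)) = (\<lambda>s. - (\<rho> * D) * e s)"
    "\<l> j \<circ> (\<lambda>t. T (0, t)) = (\<lambda>t. - (\<rho> * D))"
    by (auto simp: fun_eq_iff \<l>T Pi Pj AB e)
  moreover have "winding_number (\<lambda>t. - (\<rho> * D)) 0 = 0"
    using winding_number_trivial [of 0 "- (\<rho> * D)"] pos D
    by (simp add: linepath_refl)
  ultimately show False
    using eq rot [of "\<rho> * \<epsilon> * D"] rot [of "- (\<rho> * D)"] pos D by simp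
qed

theorem theorem1:
  fixes n :: nat
    and L :: "nat \<Rightarrow> (complex \<times> complex) set"
    and \<Sigma> :: "(complex \<times> complex) set"
    and x\<^sub>0 :: "complex \<times> complex"
  assumes "n \<ge> 2"
    and "\<And>i. i \<in> {1..n} \<Longrightarrow> is_complex_line (L i)"
    and "inj_on L {1..n}"
    and "\<Sigma> = (\<Union>i\<in>{1..n}. L i)"
    and "x\<^sub>0 \<in> - \<Sigma>"
    and "is_free_group (fundamental_group (- \<Sigma>) x\<^sub>0)"
  shows "\<forall>i\<in>{1..n}. \<forall>j\<in>{1..n}. parallel (L i) (L j)"
proof (intro ballI)
  fix i j assume ij: "i \<in> {1..n}" "j \<in> {1..n}"
  have "\<forall>k\<in>{1..n}. \<exists>a b c. (a, b) \<noteq> (0, 0) \<and> L k = {(x, y). a * x + b * y + c = 0}"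
    using assms(2) by (simp add: is_complex_line_def)
  then obtain a b c where ab: "\<And>k. k \<in> {1..n} \<Longrightarrow> (a k, b k) \<noteq> (0, 0)"
    and L: "\<And>k. k \<in> {1..n} \<Longrightarrow> L k = {(x, y). a k * x + b k * y + c k = 0}"
    by metis
  have compl: "- \<Sigma> = {z. \<forall>k\<in>{1..n}. a k * fst z + b k * snd z + c k \<noteq> 0}"
    using L by (auto simp: assms(4))
  show "parallel (L i) (L j)"
  proof (cases "a i * b j = a j * b i")
    case True
    then show ?thesis
      using parallelI [OF ab ab] ij by (simp add: L)
  next
    case False
    \<comment> \<open>A line parallel to \<open>L i\<close> and meeting it equals
      \<open>L i\<close>, so injectivity of \<open>L\<close> would give
      \<open>k = i\<close>.\<close>
    have "a k * b i \<noteq> a i * b k"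
      if "k \<in> {1..n}" "k \<noteq> i" "a k * u + b k * v + c k = 0" "a i * u + b i * v + c i = 0" for k u v
      using parallel_meet_imp_eq [OF ab ab, of k i u v "c k" "c i"] that ij assms(3) L
      by (metis inj_onD)
    with fundamental_group_two_slopes_not_free [of "{1..n}" i j a b x\<^sub>0 c] False ij
    show ?thesis
      using assms(5,6) unfolding compl by blast
  qed
qed

end
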